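(* Suppose that $V\subset \mathbb{R}P^d$ is a projective subspace of dimension $v$ and $\mu$ is a probability measure on $\mathbb{R}P^d$. Then there exists a projective subspace $W\subset \mathbb{R}P^d$ of dimension $d-v-1$ such that any pair of hyperplanes $H_1\supseteq V$ and $H_2\supseteq W$ partitions $\mathbb{R}P^d$ into two parts $P_1$ and $P_2$ so that $$ \mu(P_1),\ \mu(P_2)\ \ge\ \frac{1}{(d-v)(v+1)+1}. $$
   Context: Measures are Borel measures. Hyperplanes are projective hyperplanes of $\mathbb{R}P^d$. Any two distinct hyperplanes $H_1$ and $H_2$ partition $\mathbb{R}P^d$ into two parts, which are always taken to be closed (i.e. the closures of the two connected components of $\mathbb{R}P^d\setminus(H_1\cup H_2)$). If $H_1=H_2$, then by convention the two parts are $H_1=H_2$ itself and the whole space $\mathbb{R}P^d$. *)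

theory Defs
  imports "HOL-Probability.Probability"
begin

text \<open>The points of \<open>'n rproj\<close> are the lines through the origin of \<open>real ^ 'n\<close>, so that
  \<open>'n rproj\<close> is the real projective space of dimension \<open>CARD('n) - 1\<close>.\<close>

typedef 'n rproj = "{L :: (real ^ 'n::finite) set. subspace L \<and> dim L = 1}"
  morphisms line Abs_rproj
proof -
  have "subspace (span {axis undefined 1 :: real ^ 'n})"
    by simp
  moreover have "dim (span {axis undefined 1 :: real ^ 'n}) = 1"
    by (simp add: dim_insert axis_eq_0_iff)
  ultimately show ?thesis
    by blast
qed

text \<open>The topology is the quotient topology: the union of the lines in \<open>U\<close>, without the
  origin, is the preimage of \<open>U\<close> under the map from the nonzero vectors to their lines.\<close>

instantiation rproj :: (finite) topological_space
begin

definition open_rproj :: "'a rproj set \<Rightarrow> bool"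
  where "open_rproj U \<longleftrightarrow> open ((\<Union>p\<in>U. line p) - {0})"

lemma line_meet_eq:
  fixes p q :: "'a rproj"
  assumes "x \<in> line p" "x \<in> line q" "x \<noteq> 0"
  shows "p = q"
proof -
  have "line r = span {x}" if "x \<in> line r" for r :: "'a rproj"
  proof -
    have r: "subspace (line r)" "dim (line r) = 1"
      using line[of r] by auto
    have "span {x} \<subseteq> line r"
      using that r(1) by (simp add: span_minimal)
    moreover have "dim (span {x}) = 1"
      using assms(3) by (simp add: dim_insert)
    ultimately show ?thesis
      using r by (intro subspace_dim_equal[symmetric]) auto
  qed
  then have "line p = line q"
    using assms by blast
  then show ?thesis
    by (simp add: line_inject)
qed

instance
proof
  have "(\<Union>p::'a rproj. line p) - {0} = UNIV - {0}"
  proof -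
    have "\<exists>p. x \<in> line p" if "x \<noteq> 0" for x :: "real ^ 'a"
    proof -
      have "line (Abs_rproj (span {x})) = span {x}"
        using that by (intro Abs_rproj_inverse) (simp add: dim_insert)
      then have "x \<in> line (Abs_rproj (span {x}))"
        by (simp add: span_base)
      then show ?thesis
        by blast
    qed
    then show ?thesis
      by auto
  qed
  then show "open (UNIV :: 'a rproj set)"
    by (simp add: open_rproj_def open_delete)
next
  fix S T :: "'a rproj set"
  assume ST: "open S" "open T"
  have "(\<Union>p\<in>S \<inter> T. line p) - {0} = ((\<Union>p\<in>S. line p) - {0}) \<inter> ((\<Union>p\<in>T. line p) - {0})"
    by (auto dest: line_meet_eq)
  then show "open (S \<inter> T)"
    using ST by (simp only: open_rproj_def open_Int)
next
  fix K :: "'a rproj set set"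
  assume K: "\<forall>S\<in>K. open S"
  have "(\<Union>p\<in>\<Union>K. line p) - {0} = (\<Union>S\<in>K. (\<Union>p\<in>S. line p) - {0})"
    by auto
  moreover have "open (\<Union>S\<in>K. (\<Union>p\<in>S. line p) - {0})"
    using K by (intro open_UN) (simp only: open_rproj_def)
  ultimately show "open (\<Union>K)"
    by (simp only: open_rproj_def)
qed

end

text \<open>Dimensions are integers; the empty set is the projective subspace of dimension \<open>-1\<close>.\<close>

definition proj_subspace :: "int \<Rightarrow> 'n::finite rproj set \<Rightarrow> bool"
  where "proj_subspace k P \<longleftrightarrow>
    (\<exists>S. subspace S \<and> int (dim S) = k + 1 \<and> P = {p. line p \<subseteq> S})"

definition proj_hyperplane :: "'n::finite rproj set \<Rightarrow> bool"
  where "proj_hyperplane H \<longleftrightarrow> proj_subspace (int CARD('n) - 2) H"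

definition partitions_into ::
    "'n::finite rproj set \<Rightarrow> 'n rproj set \<Rightarrow> 'n rproj set \<Rightarrow> 'n rproj set \<Rightarrow> bool"
  where "partitions_into H1 H2 P1 P2 \<longleftrightarrow>
    (if H1 = H2 then {P1, P2} = {H1, UNIV}
     else \<exists>C1 C2. C1 \<noteq> C2 \<and> components (- (H1 \<union> H2)) = {C1, C2} \<and>
            P1 = closure C1 \<and> P2 = closure C2)"

end

theory Submission
  imports Defs
begin

text \<open>Let \<open>S\<close> be the linear subspace underlying \<open>V\<close>, of dimension \<open>k = v + 1\<close>, and let
  \<open>m = d - v\<close> be the dimension of \<open>S\<^sup>\<bottom>\<close>. A hyperplane through \<open>V\<close> is the zero set of a linear
  form \<open>f \<in> S\<^sup>\<bottom>\<close>, and if \<open>W\<close> comes from \<open>G\<^sup>\<bottom>\<close> then a hyperplane through \<open>W\<close> is the zero set of a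
  linear form \<open>g \<in> G\<close>. The two parts are \<open>{f g \<ge> 0}\<close> and \<open>{f g \<le> 0}\<close>, and exchanging \<open>g\<close> and
  \<open>- g\<close> exchanges them (\<open>partition_by_forms\<close>; one choice of sign also gives the convention
  for equal hyperplanes). So what is needed is a \<open>k\<close>-dimensional space \<open>G\<close> of linear forms
  such that \<open>{f g \<ge> 0}\<close> has measure at least \<open>1 / (k m + 1)\<close> for all \<open>f \<in> S\<^sup>\<bottom>\<close> and \<open>g \<in> G\<close>
  (\<open>dual_subspace_exists\<close>).

  The candidates for \<open>W\<close> that are complementary to \<open>V\<close> are the graphs of the linear maps
  \<open>A\<close> from \<open>S\<^sup>\<bottom>\<close> to \<open>S\<close>, which form a space \<open>L\<close> of dimension \<open>k m\<close>. Write a unit vector as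
  \<open>z = x + y\<close> with \<open>x \<in> S\<close> and \<open>y \<in> S\<^sup>\<bottom>\<close>. For \<open>f = b\<close> in \<open>S\<^sup>\<bottom>\<close>, and for the form
  \<open>g(z) = a \<bullet> (x - A y)\<close> with \<open>a \<in> S\<close>, which vanishes on the graph, the product \<open>f g\<close> at \<open>z\<close>
  is the inner product of the rank-one map \<open>a \<otimes> b\<close> with \<open>(x - A y) \<otimes> y\<close>. Thus every point of
  projective space defines a vector field \<open>A \<mapsto> (x - A y) \<otimes> y\<close> on \<open>L\<close>, and it suffices to find
  an \<open>A\<close> at which \<open>0\<close> is a centre point of the random vector given by the measure, that
  is, every closed half-space bounded by a hyperplane through \<open>0\<close> has probability at least
  \<open>1 / (k m + 1)\<close>.

  Such an \<open>A\<close> is found by Brouwer's theorem (\<open>vector_field_centerpoint\<close>). If \<open>0\<close> were never a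
  centre point, each \<open>A\<close> would have a direction that pairs nonnegatively with the field only
  on a set of measure below \<open>1 / (k m + 1)\<close>. A partition of unity glues these directions
  together continuously. By Caratheodory's theorem only \<open>k m + 1\<close> of them matter at a given
  \<open>A\<close>, so some point of projective space has a field vector that pairs negatively with all of
  them. A variational inequality obtained from a fixed point excludes this, as long as the
  fields point into the domain.

  To make the fields point into a large ball, the term \<open>- \<epsilon> A\<close> is added; it is the negative
  gradient of a quadratic penalty on \<open>A\<close>. The condition becomes that \<open>f g + \<epsilon> (f \<bullet> g) \<ge> 0\<close> on a set of
  large measure, in which \<open>A\<close> occurs only through \<open>g\<close> (\<open>regularized_subspace_exists\<close>). Hence one may
  let \<open>\<epsilon>\<close> tend to \<open>0\<close> even if the maps \<open>A\<close> are unbounded: only the spaces \<open>G\<close> have to converge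
  along a subsequence, and they do by compactness (\<open>convergent_subspaces\<close>). The limit
  \<open>G\<^sup>\<bottom>\<close> may meet \<open>S\<close>, which is how \<open>H1 = H2\<close> can occur.\<close>

section \<open>Measures of sets where a function is nonnegative\<close>

text \<open>The upper limit of the sets \<open>{h j \<ge> 0}\<close> has measure at least \<open>c\<close> and lies in \<open>{g \<ge> 0}\<close>.
  This is used twice: the points at which a vector field violates the bound in a given
  direction form an open set, and the regularization can be removed in the limit.\<close>

lemma measure_nonneg_limit:
  fixes h :: "nat \<Rightarrow> 'z \<Rightarrow> real"
  assumes "finite_measure M"
    and h: "\<And>j. h j \<in> borel_measurable M" and g: "g \<in> borel_measurable M"
    and lim: "\<And>z. z \<in> space M \<Longrightarrow> (\<lambda>j. h j z) \<longlonglongrightarrow> g z"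
    and ge: "\<And>j. c \<le> measure M {z \<in> space M. 0 \<le> h j z}"
  shows "c \<le> measure M {z \<in> space M. 0 \<le> g z}"
proof -
  interpret finite_measure M by fact
  define T where "T N = (\<Union>j\<in>{N..}. {z \<in> space M. 0 \<le> h j z})" for N
  have meas: "{z \<in> space M. 0 \<le> h j z} \<in> sets M" for j
    using h by measurable
  have T: "T N \<in> sets M" for N
    unfolding T_def using meas by (intro sets.countable_UN') auto
  have "c \<le> measure M (T N)" for N
  proof -
    have "measure M {z \<in> space M. 0 \<le> h N z} \<le> measure M (T N)"
      using T by (intro finite_measure_mono) (auto simp: T_def)
    with ge[of N] show ?thesis by simp
  qed
  moreover have "decseq T"
    unfolding decseq_def T_def by (intro allI impI UN_mono) auto
  then have "(\<lambda>N. measure M (T N)) \<longlonglongrightarrow> measure M (\<Inter>N. T N)"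
    using T by (intro finite_Lim_measure_decseq) auto
  ultimately have "c \<le> measure M (\<Inter>N. T N)"
    by (intro LIMSEQ_le_const) auto
  also have "\<dots> \<le> measure M {z \<in> space M. 0 \<le> g z}"
  proof (intro finite_measure_mono subsetI)
    fix z assume z: "z \<in> (\<Inter>N. T N)"
    then have sp: "z \<in> space M" by (auto simp: T_def)
    have "0 \<le> g z"
    proof (rule ccontr)
      assume "\<not> 0 \<le> g z"
      then have "eventually (\<lambda>j. h j z < 0) sequentially"
        using lim[OF sp] by (intro order_tendstoD) auto
      then obtain N where "\<And>j. j \<ge> N \<Longrightarrow> h j z < 0"
        by (auto simp: eventually_sequentially)
      moreover from z have "z \<in> T N" by blast
      ultimately show False by (force simp: T_def)
    qed
    with sp show "z \<in> {z \<in> space M. 0 \<le> g z}" by simp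
  qed (use g in measurable)
  finally show ?thesis .
qed

text \<open>The union bound, in the form in which it combines with Caratheodory's theorem.\<close>

lemma common_negative_point:
  fixes X :: "'i \<Rightarrow> 'z \<Rightarrow> real"
  assumes "prob_space M" "finite s" "s \<noteq> {}" "card s \<le> N"
    and X: "\<And>b. b \<in> s \<Longrightarrow> X b \<in> borel_measurable M"
    and small: "\<And>b. b \<in> s \<Longrightarrow> measure M {z \<in> space M. 0 \<le> X b z} < 1 / real N"
  shows "\<exists>z\<in>space M. \<forall>b\<in>s. X b z < 0"
proof (rule ccontr)
  assume neg: "\<not> ?thesis"
  interpret prob_space M by fact
  have meas: "{z \<in> space M. 0 \<le> X b z} \<in> sets M" if "b \<in> s" for b
    using X[OF that] by measurable
  have "N > 0"
    using assms by (metis card_gt_0_iff gr0I le_zero_eq)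
  have "space M \<subseteq> (\<Union>b\<in>s. {z \<in> space M. 0 \<le> X b z})"
    using neg by (auto simp: not_less)
  then have "measure M (space M) \<le> measure M (\<Union>b\<in>s. {z \<in> space M. 0 \<le> X b z})"
    using meas \<open>finite s\<close> by (intro finite_measure_mono) auto
  also have "\<dots> \<le> (\<Sum>b\<in>s. measure M {z \<in> space M. 0 \<le> X b z})"
    using meas \<open>finite s\<close> by (intro finite_measure_subadditive_finite) auto
  also have "\<dots> < (\<Sum>b\<in>s. 1 / real N)"
    using assms by (intro sum_strict_mono) auto
  also have "\<dots> = real (card s) / real N" by simp
  also have "\<dots> \<le> 1" using \<open>card s \<le> N\<close> \<open>N > 0\<close> by simp
  finally show False using prob_space by simp
qed

section \<open>A centre point theorem for random vector fields\<close>

text \<open>For the fields \<open>F z A = z - A\<close> with \<open>z \<in> K\<close> this is the centre point theorem in \<open>K\<close>.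
  The space \<open>L\<close> is kept apart from the ambient space because its dimension enters the bound.\<close>

theorem vector_field_centerpoint:
  fixes F :: "'z \<Rightarrow> 'a::euclidean_space \<Rightarrow> 'a"
  assumes "prob_space M" and L: "subspace L"
    and K: "compact K" "convex K" "K \<noteq> {}"
    and meas: "\<And>A B. A \<in> K \<Longrightarrow> (\<lambda>z. F z A \<bullet> B) \<in> borel_measurable M"
    and cont: "\<And>z. z \<in> space M \<Longrightarrow> continuous_on K (F z)"
    and inward: "\<And>z A. z \<in> space M \<Longrightarrow> A \<in> K \<Longrightarrow> \<exists>t>0. A + t *\<^sub>R F z A \<in> K"
  shows "\<exists>A\<in>K. \<forall>B\<in>L. 1 / real (dim L + 1) \<le> measure M {z \<in> space M. 0 \<le> F z A \<bullet> B}"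
proof (rule ccontr)
  assume neg: "\<not> ?thesis"
  interpret prob_space M by fact
  define c where "c = 1 / real (dim L + 1)"
  define bad where "bad B = {A \<in> K. measure M {z \<in> space M. 0 \<le> F z A \<bullet> B} < c}" for B
  have "closed (K - bad B)" for B
    unfolding closed_sequential_limits
  proof (intro allI impI, elim conjE)
    fix x l assume x: "\<forall>n. x n \<in> K - bad B" and l: "x \<longlonglongrightarrow> l"
    have "l \<in> K"
      using x l K(1) by (metis DiffD1 closed_sequentially compact_imp_closed)
    have "c \<le> measure M {z \<in> space M. 0 \<le> F z l \<bullet> B}"
    proof (rule measure_nonneg_limit[where h = "\<lambda>j z. F z (x j) \<bullet> B"])
      fix z assume z: "z \<in> space M"
      have "(\<lambda>j. F z (x j)) \<longlonglongrightarrow> F z l"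
        using cont[OF z] x l \<open>l \<in> K\<close> by (auto simp: continuous_on_sequentially o_def)
      then show "(\<lambda>j. F z (x j) \<bullet> B) \<longlonglongrightarrow> F z l \<bullet> B"
        by (intro tendsto_intros)
    next
      show "c \<le> measure M {z \<in> space M. 0 \<le> F z (x j) \<bullet> B}" for j
        using x[rule_format, of j] by (auto simp: bad_def not_less)
    qed (use x \<open>l \<in> K\<close> in \<open>auto intro!: meas finite_measure_axioms\<close>)
    with \<open>l \<in> K\<close> show "l \<in> K - bad B" by (auto simp: bad_def)
  qed
  then have op: "open (- (K - bad B))" for B by (rule open_Compl)
  have "K \<subseteq> (\<Union>B\<in>L. - (K - bad B))"
    using neg by (force simp: bad_def c_def not_le)
  then obtain L' where L': "L' \<subseteq> L" "finite L'" "K \<subseteq> (\<Union>B\<in>L'. - (K - bad B))"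
    using compactE_image[OF K(1), of L "\<lambda>B. - (K - bad B)"] op by metis
  define \<C> where "\<C> = (\<lambda>B. - (K - bad B)) ` L'"
  have fin: "finite \<C>" using L' by (simp add: \<C>_def)
  have cov: "K \<subseteq> \<Union>\<C>" and op\<C>: "\<And>U. U \<in> \<C> \<Longrightarrow> open U"
    using L'(3) op by (auto simp: \<C>_def)
  have nb: "\<exists>V. open V \<and> x \<in> V \<and> finite {U \<in> \<C>. U \<inter> V \<noteq> {}}" for x
    using fin by (intro exI[of _ UNIV]) auto
  obtain \<phi> :: "'a set \<Rightarrow> 'a \<Rightarrow> real" where
    \<phi>: "\<And>U. U \<in> \<C> \<Longrightarrow> continuous_on K (\<phi> U) \<and> (\<forall>x\<in>K. 0 \<le> \<phi> U x)"
      "\<And>x U. \<lbrakk>U \<in> \<C>; x \<in> K; x \<notin> U\<rbrakk> \<Longrightarrow> \<phi> U x = 0"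
      "\<And>x. x \<in> K \<Longrightarrow> supp_sum (\<lambda>W. \<phi> W x) \<C> = 1"
    by (rule subordinate_partition_of_unity[OF cov op\<C> nb]) (assumption | rule that)+
  have sum1: "(\<Sum>U\<in>\<C>. \<phi> U A) = 1" if "A \<in> K" for A
  proof -
    have "(\<Sum>U\<in>\<C>. \<phi> U A) = supp_sum (\<lambda>U. \<phi> U A) \<C>"
      unfolding supp_sum_def support_on_def using fin by (intro sum.mono_neutral_right) auto
    with \<phi>(3)[OF that] show ?thesis by simp
  qed
  have "\<forall>U\<in>\<C>. \<exists>B\<in>L. U = - (K - bad B)" using L' by (auto simp: \<C>_def)
  then obtain b where b: "\<And>U. U \<in> \<C> \<Longrightarrow> b U \<in> L" "\<And>U. U \<in> \<C> \<Longrightarrow> U = - (K - bad (b U))"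
    by metis
  define G where "G A = (\<Sum>U\<in>\<C>. \<phi> U A *\<^sub>R b U)" for A
  have contG: "continuous_on K G"
    unfolding G_def using \<phi>(1) by (intro continuous_intros) auto
  have "closed K" using K(1) by (rule compact_imp_closed)
  \<comment> \<open>The projection makes a self-map of \<open>K\<close> whose fixed points solve a variational inequality.\<close>
  obtain A where A: "A \<in> K" "closest_point K (A - G A) = A"
  proof (rule brouwer[OF K, of "\<lambda>A. closest_point K (A - G A)"])
    show "continuous_on K (\<lambda>A. closest_point K (A - G A))"
      by (rule continuous_on_compose2[OF continuous_on_closest_point[OF K(2) \<open>closed K\<close> K(3), of UNIV]])
        (auto intro!: continuous_intros contG)
  qed (use closest_point_in_set[OF \<open>closed K\<close> K(3)] in auto)
  have VI: "0 \<le> G A \<bullet> (A' - A)" if "A' \<in> K" for A'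
    using closest_point_dot[OF K(2) \<open>closed K\<close> that, of "A - G A"] A(2) by simp
  define act where "act = b ` {U \<in> \<C>. \<phi> U A \<noteq> 0}"
  have actL: "act \<subseteq> L" using b by (auto simp: act_def)
  have actbad: "measure M {z \<in> space M. 0 \<le> F z A \<bullet> B} < c" if B: "B \<in> act" for B
  proof -
    obtain U where U: "U \<in> \<C>" "\<phi> U A \<noteq> 0" "B = b U" using B by (auto simp: act_def)
    then have "A \<in> U" using \<phi>(2) A(1) by blast
    then have "A \<in> bad B" using b(2)[OF U(1)] A(1) U(3) by auto
    then show ?thesis by (simp add: bad_def)
  qed
  have GA: "G A = (\<Sum>U\<in>{U \<in> \<C>. \<phi> U A \<noteq> 0}. \<phi> U A *\<^sub>R b U)"
    unfolding G_def using fin by (intro sum.mono_neutral_right) auto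
  have "(\<Sum>U\<in>{U \<in> \<C>. \<phi> U A \<noteq> 0}. \<phi> U A) = 1"
    using sum1[OF A(1)] fin by (subst sum.mono_neutral_left[of \<C>]) auto
  then have "G A \<in> convex hull act"
    unfolding GA using fin \<phi>(1) A(1)
    by (intro convex_sum[OF _ convex_convex_hull]) (auto simp: act_def intro: hull_inc)
  then obtain s u where s: "finite s" "s \<subseteq> act" "int (card s) \<le> aff_dim act + 1"
    "\<And>x. x \<in> s \<Longrightarrow> 0 \<le> u x" "sum u s = 1" "(\<Sum>v\<in>s. u v *\<^sub>R v) = G A"
    unfolding convex_hull_caratheodory_aff_dim by blast
  have "aff_dim act \<le> int (dim L)"
    using aff_dim_subset[OF actL] L by (simp add: aff_dim_subspace)
  then have cs: "card s \<le> dim L + 1" using s(3) by linarith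
  have "s \<noteq> {}" using s(5) by auto
  \<comment> \<open>All active directions are bad at \<open>A\<close>, and Caratheodory leaves too few of them to cover.\<close>
  obtain z where z: "z \<in> space M" "\<And>B. B \<in> s \<Longrightarrow> F z A \<bullet> B < 0"
    using common_negative_point[OF prob_space_axioms s(1) \<open>s \<noteq> {}\<close> cs, of "\<lambda>B z. F z A \<bullet> B"]
      s(2) actbad meas[OF A(1)] unfolding c_def by blast
  obtain B where B: "B \<in> s" "u B > 0"
    using s(1,4,5) by (metis less_eq_real_def sum.neutral zero_neq_one)
  have "(\<Sum>v\<in>s. u v * (F z A \<bullet> v)) < (\<Sum>v\<in>s. 0)"
    using s(1,4) B z(2)
    by (intro sum_strict_mono_ex1) (auto simp: mult_le_0_iff mult_less_0_iff less_imp_le)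
  then have neg: "F z A \<bullet> G A < 0"
    unfolding s(6)[symmetric] by (simp add: inner_sum_right)
  obtain t where t: "t > 0" "A + t *\<^sub>R F z A \<in> K" using inward[OF z(1) A(1)] by blast
  have "0 \<le> t * (G A \<bullet> F z A)" using VI[OF t(2)] by simp
  with neg t(1) show False by (simp add: zero_le_mult_iff inner_commute)
qed

section \<open>Matrices from a subspace complement to a subspace\<close>

definition outer :: "real ^ 'n \<Rightarrow> real ^ 'n \<Rightarrow> real ^ 'n ^ 'n::finite"
  where "outer u v = (\<chi> i j. u $ i * v $ j)"

lemma outer_inner: "outer u v \<bullet> B = u \<bullet> (B *v v)"
  by (simp add: outer_def inner_vec_def matrix_vector_mult_def sum_distrib_left mult_ac)

lemma outer_apply: "outer u v *v w = (v \<bullet> w) *\<^sub>R u"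
  by (simp add: outer_def inner_vec_def matrix_vector_mult_def vec_eq_iff sum_distrib_left
      sum_distrib_right mult_ac)

lemma bilinear_outer: "bilinear outer"
  by (auto simp: bilinear_def linear_iff outer_def vec_eq_iff algebra_simps)

lemma norm_outer: "norm (outer u v) = norm u * norm v"
  by (simp add: norm_eq_sqrt_inner outer_inner outer_apply real_sqrt_mult mult.commute)

text \<open>Cauchy-Schwarz for the pairing of \<open>A\<close> with the rank-one matrix \<open>outer (A *v y) y\<close>.\<close>

lemma norm_matrix_vector_le: "norm (A *v y) \<le> norm A * norm y" for A :: "real ^ 'n ^ 'n"
proof -
  have "norm (A *v y) * norm (A *v y) = outer (A *v y) y \<bullet> A"
    by (simp add: outer_inner power2_norm_eq_inner flip: power2_eq_square)
  also have "\<dots> \<le> norm (A *v y) * norm y * norm A"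
    by (metis norm_cauchy_schwarz norm_outer)
  finally show ?thesis
    by (cases "A *v y = 0") (auto simp: mult_ac)
qed

text \<open>The matrices that map \<open>S\<^sup>\<bottom>\<close> into \<open>S\<close> and vanish on \<open>S\<close>. A span of rank-one matrices makes
  the dimension bound a matter of counting products of basis vectors.\<close>

definition hom_space :: "(real ^ 'n) set \<Rightarrow> (real ^ 'n::finite ^ 'n) set"
  where "hom_space S = span {outer a b | a b. a \<in> S \<and> b \<in> S\<^sup>\<bottom>}"

lemma dim_hom_space:
  fixes S :: "(real ^ 'n::finite) set"
  assumes "subspace S"
  shows "dim (hom_space S) \<le> dim S * dim (S\<^sup>\<bottom>)"
proof -
  obtain B where B: "finite B" "card B = dim S" "S \<subseteq> span B"
    by (metis basis_exists independent_imp_finite)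
  obtain C where C: "finite C" "card C = dim (S\<^sup>\<bottom>)" "S\<^sup>\<bottom> \<subseteq> span C"
    by (metis basis_exists independent_imp_finite)
  let ?T = "case_prod outer ` (B \<times> C)"
  have "outer a b \<in> span ?T" if a: "a \<in> span B" and b: "b \<in> span C" for a b
  proof -
    have "bilinear (outer :: real ^ 'n \<Rightarrow> _)" by (rule bilinear_outer)
    then interpret o: linear "outer a'" + o': linear "\<lambda>a. outer a a'" for a' :: "real ^ 'n"
      by (auto simp: bilinear_def)
    have *: "outer a' b \<in> span ?T" if "a' \<in> B" for a'
    proof -
      have "outer a' ` span C = span (outer a' ` C)"
        by (rule linear_span_image[OF o.linear_axioms, symmetric])
      also have "\<dots> \<subseteq> span ?T"
        using that by (intro span_mono) auto
      finally show ?thesis using b by blast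
    qed
    have "(\<lambda>a. outer a b) ` span B = span ((\<lambda>a. outer a b) ` B)"
      by (rule linear_span_image[OF o'.linear_axioms, symmetric])
    also have "\<dots> \<subseteq> span ?T"
      using * by (intro span_minimal) auto
    finally show ?thesis using a by blast
  qed
  then have "hom_space S \<subseteq> span ?T"
    unfolding hom_space_def using B(3) C(3) by (intro span_minimal) auto
  then have "dim (hom_space S) \<le> card ?T"
    using B(1) C(1) by (metis dim_le_card dim_span finite_cartesian_product finite_imageI span_minimal subspace_span)
  also have "\<dots> \<le> card (B \<times> C)"
    using B(1) C(1) by (intro card_image_le) auto
  finally show ?thesis by (simp add: B C card_cartesian_product)
qed

lemma hom_space_apply: "A *v y \<in> S" if "A \<in> hom_space S" "subspace S" for A :: "real ^ 'n::finite ^ 'n"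
proof -
  have "subspace {A :: real ^ 'n ^ 'n. A *v y \<in> S}"
    using that(2) by (auto simp: subspace_def matrix_vector_mult_add_rdistrib scaleR_matrix_vector_assoc[symmetric])
  then have "hom_space S \<subseteq> {A. A *v y \<in> S}"
    unfolding hom_space_def using that(2)
    by (intro span_minimal) (auto simp: outer_apply subspace_scale)
  with that show ?thesis by auto
qed

lemma hom_space_apply_eq_0:
  fixes A :: "real ^ 'n::finite ^ 'n"
  assumes "A \<in> hom_space S" "s \<in> S"
  shows "A *v s = 0"
proof -
  have "subspace {A :: real ^ 'n ^ 'n. A *v s = 0}"
    by (auto simp: subspace_def matrix_vector_mult_add_rdistrib scaleR_matrix_vector_assoc[symmetric])
  then have "hom_space S \<subseteq> {A. A *v s = 0}"
    unfolding hom_space_def using assms(2)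
    by (intro span_minimal) (auto simp: outer_apply orthogonal_comp_def orthogonal_def inner_commute)
  with assms show ?thesis by auto
qed

section \<open>Orthogonal projections and steps in a ball\<close>

lemma orthogonal_projection_exists:
  fixes S :: "'a::euclidean_space set"
  assumes "subspace S"
  obtains P where "linear P" "\<And>z. P z \<in> S" "\<And>z. z - P z \<in> S\<^sup>\<bottom>"
proof -
  obtain B where B: "B \<subseteq> S" "pairwise orthogonal B" "\<And>x. x \<in> B \<Longrightarrow> norm x = 1"
    "independent B" "span B = S"
    using orthonormal_basis_subspace[OF assms] by metis
  have fin: "finite B" using B(4) by (rule independent_imp_finite)
  define P where "P z = (\<Sum>b\<in>B. (b \<bullet> z) *\<^sub>R b)" for z
  show thesis
  proof
    show "linear P"
      unfolding P_def by (auto simp: linear_iff inner_add_right scaleR_add_left sum.distrib scaleR_sum_right)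
    show "P z \<in> S" for z
      unfolding P_def using B(1) assms by (intro subspace_sum subspace_scale) auto
    show "z - P z \<in> S\<^sup>\<bottom>" for z
    proof -
      have "b \<bullet> (z - P z) = 0" if "b \<in> B" for b
      proof -
        have "b \<bullet> P z = (\<Sum>c\<in>B. if c = b then b \<bullet> z else 0)"
          unfolding P_def inner_sum_right using B(2,3) that
          by (intro sum.cong) (auto simp: pairwise_def orthogonal_def norm_eq_1)
        then show ?thesis using that fin by (simp add: inner_diff_right)
      qed
      then have "B \<subseteq> {x. x \<bullet> (z - P z) = 0}" by auto
      then have "S \<subseteq> {x. x \<bullet> (z - P z) = 0}"
        using B(5) span_minimal[OF _ subspace_hyperplane2] by metis
      then show ?thesis by (auto simp: orthogonal_comp_def orthogonal_def)
    qed
  qed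
qed

lemma orthogonal_split:
  assumes "z = x + y" "x \<in> S" "y \<in> S\<^sup>\<bottom>" "norm z = 1"
  shows "norm x \<le> 1" "norm y \<le> 1"
proof -
  have "orthogonal x y" using assms by (auto simp: orthogonal_comp_def)
  then have "(norm x)\<^sup>2 + (norm y)\<^sup>2 = 1"
    using assms norm_add_Pythagorean by fastforce
  then have "(norm x)\<^sup>2 \<le> 1\<^sup>2" "(norm y)\<^sup>2 \<le> 1\<^sup>2"
    by (smt (verit) zero_le_power2 one_power2)+
  then show "norm x \<le> 1" "norm y \<le> 1" by (auto intro: power2_le_imp_le)
qed

lemma dim_orthogonal_comp:
  fixes S :: "'a::euclidean_space set"
  assumes "subspace S"
  shows "dim (S\<^sup>\<bottom>) = DIM('a) - dim S"
proof -
  have "dim {y \<in> UNIV. \<forall>x\<in>S. orthogonal x y} + dim S = dim (UNIV :: 'a set)"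
    using assms by (intro dim_subspace_orthogonal_to_vectors) auto
  then show ?thesis by (simp add: orthogonal_comp_def)
qed

text \<open>Vectors at interior points always point into the ball; on the sphere, the derivative
  \<open>2 (A \<bullet> X)\<close> of the squared norm decides.\<close>

lemma step_stays_in_ball:
  fixes A X :: "'a::real_inner"
  assumes "norm A \<le> R" "norm A = R \<Longrightarrow> A \<bullet> X < 0"
  shows "\<exists>t>0. norm (A + t *\<^sub>R X) \<le> R"
proof -
  have "\<forall>\<^sub>F t in at_right 0. norm (A + t *\<^sub>R X) \<le> R"
  proof (cases "norm A = R")
    case False
    have "((\<lambda>t. norm (A + t *\<^sub>R X)) \<longlongrightarrow> norm (A + 0 *\<^sub>R X)) (at_right 0)"
      by (intro tendsto_intros)
    then show ?thesis
      using False assms(1) order_tendstoD(2)[of "\<lambda>t. norm (A + t *\<^sub>R X)" "norm A" "at_right 0" R]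
      by (auto elim!: eventually_mono simp: less_imp_le)
  next
    case True
    then have neg: "A \<bullet> X < 0" by fact
    have "((\<lambda>t. 2 * (A \<bullet> X) + t * (X \<bullet> X)) \<longlongrightarrow> 2 * (A \<bullet> X) + 0 * (X \<bullet> X)) (at_right 0)"
      by (intro tendsto_intros)
    then have "\<forall>\<^sub>F t in at_right 0. 2 * (A \<bullet> X) + t * (X \<bullet> X) < 0"
      using neg by (intro order_tendstoD(2)[where y = "2 * (A \<bullet> X) + 0 * (X \<bullet> X)"]) auto
    moreover have "\<forall>\<^sub>F t :: real in at_right 0. t > 0"
      by (simp add: eventually_at_right_less)
    ultimately show ?thesis
    proof eventually_elim
      case (elim t)
      have "(norm (A + t *\<^sub>R X))\<^sup>2 = (norm A)\<^sup>2 + t * (2 * (A \<bullet> X) + t * (X \<bullet> X))"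
        by (simp add: power2_norm_eq_inner inner_add_left inner_add_right inner_commute algebra_simps)
      also have "\<dots> \<le> (norm A)\<^sup>2"
        using elim by (simp add: mult_le_0_iff)
      finally show ?case
        using True by (metis norm_ge_zero power2_le_imp_le)
    qed
  qed
  moreover have "\<forall>\<^sub>F t :: real in at_right 0. t > 0"
    by (simp add: eventually_at_right_less)
  ultimately have "\<forall>\<^sub>F t :: real in at_right 0. t > 0 \<and> norm (A + t *\<^sub>R X) \<le> R"
    by eventually_elim auto
  then show ?thesis
    using eventually_happens by fastforce
qed

section \<open>The regularized problem\<close>

lemma inner_vector_matrix_mult: "x \<bullet> (y v* A) = (A *v x) \<bullet> y" for A :: "real ^ 'n ^ 'n"
  by (metis dot_lmul_matrix inner_commute)

text \<open>The space \<open>G\<close> consists of the normals \<open>a - A\<^sup>T a\<close>, for \<open>a \<in> S\<close>, of the hyperplanes that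
  contain the graph of \<open>A\<close>. The regularizing term \<open>- \<epsilon> (A \<bullet> (a \<otimes> f))\<close> equals
  \<open>\<epsilon> (f \<bullet> g)\<close> for the normal \<open>g\<close> that belongs to \<open>a\<close>, so it is small whenever \<open>\<epsilon>\<close> is,
  uniformly over bounded \<open>f\<close> and \<open>g\<close>. Measurability is asked of even functions only, since
  a point of projective space determines its unit vector up to sign.\<close>

lemma regularized_subspace_exists:
  fixes z :: "'p \<Rightarrow> real ^ 'n::finite" and S :: "(real ^ 'n) set"
  assumes M: "prob_space M" and S: "subspace S" and \<epsilon>: "\<epsilon> > 0"
    and unit: "\<And>p. p \<in> space M \<Longrightarrow> norm (z p) = 1"
    and meas: "\<forall>F :: real ^ 'n \<Rightarrow> real. continuous_on UNIV F \<longrightarrow> (\<forall>x. F (- x) = F x) \<longrightarrow>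
      (\<lambda>p. F (z p)) \<in> borel_measurable M"
  shows "\<exists>G. subspace G \<and> dim G = dim S \<and>
    (\<forall>f\<in>S\<^sup>\<bottom>. \<forall>g\<in>G. 1 / real (dim S * dim (S\<^sup>\<bottom>) + 1)
      \<le> measure M {p \<in> space M. 0 \<le> (f \<bullet> z p) * (g \<bullet> z p) + \<epsilon> * (f \<bullet> g)})"
proof -
  obtain P where P: "linear P" "\<And>w. P w \<in> S" "\<And>w. w - P w \<in> S\<^sup>\<bottom>"
    using orthogonal_projection_exists[OF S] by blast
  define Q where "Q w = w - P w" for w
  have Q: "linear Q" "\<And>w. Q w \<in> S\<^sup>\<bottom>"
    using P linear_compose_sub[OF linear_ident P(1)] by (auto simp: Q_def[abs_def])
  have contPQ: "continuous_on T P" "continuous_on T Q" for T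
    using P(1) Q(1) by (simp_all add: linear_continuous_on linear_linear)
  have ort: "a \<bullet> b = 0" if "a \<in> S" "b \<in> S\<^sup>\<bottom>" for a b
    using that by (auto simp: orthogonal_comp_def orthogonal_def)
  define X where "X p A = outer (P (z p) - A *v Q (z p)) (Q (z p)) - \<epsilon> *\<^sub>R A" for p A
  define L where "L = hom_space S"
  have subL: "subspace L" by (simp add: L_def hom_space_def)
  \<comment> \<open>On the sphere of this radius the penalty outweighs the term \<open>x \<bullet> A y\<close>, which is at most \<open>R\<close>.\<close>
  define R where "R = 1 / \<epsilon> + 1"
  define K where "K = cball 0 R \<inter> L"
  have X_inner: "X p A \<bullet> B = (P (z p) - A *v Q (z p)) \<bullet> (B *v Q (z p)) - \<epsilon> * (A \<bullet> B)" for p A B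
    by (simp add: X_def inner_diff_left outer_inner)
  have "\<exists>A\<in>K. \<forall>B\<in>L. 1 / real (dim L + 1) \<le> measure M {p \<in> space M. 0 \<le> X p A \<bullet> B}"
  proof (rule vector_field_centerpoint[OF M subL])
    show "compact K" unfolding K_def using subL by (intro compact_Int_closed closed_subspace) auto
    show "convex K" unfolding K_def using subL by (intro convex_Int convex_cball subspace_imp_convex)
    have "0 \<in> K" using \<epsilon> subL by (auto simp: K_def R_def subspace_0)
    then show "K \<noteq> {}" by blast
  next
    fix A B :: "real ^ 'n ^ 'n"
    let ?F = "\<lambda>w. (P w - A *v Q w) \<bullet> (B *v Q w) - \<epsilon> * (A \<bullet> B)"
    have "continuous_on UNIV ?F"
      by (intro continuous_intros contPQ continuous_on_compose2[OF matrix_vector_mult_linear_continuous_on contPQ(2)]) auto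
    moreover have vector_neg: "B *v (- w) = - (B *v w)" for B :: "real ^ 'n ^ 'n" and w
      by (simp add: linear_neg)
    have "?F (- w) = ?F w" for w
      using P(1) Q(1) by (simp add: linear_neg vector_neg inner_diff_left algebra_simps)
    ultimately show "(\<lambda>p. X p A \<bullet> B) \<in> borel_measurable M"
      unfolding X_inner by (rule meas[rule_format])
  next
    fix p
    have "linear (\<lambda>A. outer (A *v Q (z p)) (Q (z p)))"
      by (auto simp: linear_iff outer_def vec_eq_iff matrix_vector_mult_add_rdistrib algebra_simps
          scaleR_matrix_vector_assoc[symmetric])
    then have "continuous_on K (\<lambda>A. outer (A *v Q (z p)) (Q (z p)))"
      by (simp add: linear_continuous_on linear_linear)
    moreover have "X p = (\<lambda>A. outer (P (z p)) (Q (z p)) - outer (A *v Q (z p)) (Q (z p)) - \<epsilon> *\<^sub>R A)"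
      by (auto simp: X_def outer_def vec_eq_iff algebra_simps)
    ultimately show "continuous_on K (X p)"
      by (auto intro!: continuous_intros)
  next
    fix p A assume p: "p \<in> space M" and A: "A \<in> K"
    let ?x = "P (z p)" and ?y = "Q (z p)"
    have AL: "A \<in> L" and AR: "norm A \<le> R" using A by (auto simp: K_def)
    have "?x - A *v ?y \<in> S"
      using P(2) hom_space_apply[OF AL[unfolded L_def] S] S by (intro subspace_diff)
    then have "outer (?x - A *v ?y) ?y \<in> L"
      unfolding L_def hom_space_def using Q(2) by (intro span_base) blast
    then have "X p A \<in> L"
      unfolding X_def using AL subL by (intro subspace_diff subspace_scale)
    have "A \<bullet> X p A < 0" if R: "norm A = R"
    proof -
      have n: "norm ?x \<le> 1" "norm ?y \<le> 1"
        using orthogonal_split[of "z p" ?x ?y S] P(2) Q(2) unit[OF p] by (auto simp: Q_def)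
      have "?x \<bullet> (A *v ?y) \<le> norm ?x * norm (A *v ?y)" by (rule norm_cauchy_schwarz)
      also have "\<dots> \<le> 1 * (norm A * norm ?y)"
        using n norm_matrix_vector_le by (intro mult_mono) auto
      also have "\<dots> \<le> norm A * 1"
        using n by (simp add: mult_left_le)
      finally have "?x \<bullet> (A *v ?y) \<le> R" using R by simp
      moreover have "0 \<le> (A *v ?y) \<bullet> (A *v ?y)" by simp
      moreover have "A \<bullet> X p A = ?x \<bullet> (A *v ?y) - (A *v ?y) \<bullet> (A *v ?y) - \<epsilon> * R\<^sup>2"
        using X_inner[of p A A] R
        by (simp only: inner_commute[of A] inner_diff_left flip: power2_norm_eq_inner)
      ultimately have "A \<bullet> X p A \<le> R - \<epsilon> * R\<^sup>2" by linarith
      also have "\<dots> = - \<epsilon> * R"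
        using \<epsilon> by (simp add: R_def power2_eq_square field_simps)
      also have "\<dots> < 0" using \<epsilon> by (simp add: R_def add_pos_pos)
      finally show ?thesis .
    qed
    then obtain t where "t > 0" "norm (A + t *\<^sub>R X p A) \<le> R"
      using step_stays_in_ball[OF AR] by blast
    moreover have "A + t *\<^sub>R X p A \<in> L"
      using AL \<open>X p A \<in> L\<close> subL by (intro subspace_add subspace_scale)
    ultimately show "\<exists>t>0. A + t *\<^sub>R X p A \<in> K" by (auto simp: K_def)
  qed
  then obtain A where AL: "A \<in> L" and A: "\<And>B. B \<in> L \<Longrightarrow>
      1 / real (dim L + 1) \<le> measure M {p \<in> space M. 0 \<le> X p A \<bullet> B}"
    by (auto simp: K_def)
  define \<gamma> where "\<gamma> a = a - a v* A" for a
  have lin: "linear \<gamma>"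
    unfolding \<gamma>_def[abs_def] transpose_matrix_vector[symmetric]
    by (rule linear_compose_sub[OF linear_ident matrix_vector_mul_linear])
  have At: "a v* A \<in> S\<^sup>\<bottom>" for a
    using hom_space_apply_eq_0[OF AL[unfolded L_def]]
    by (auto simp: orthogonal_comp_def orthogonal_def inner_vector_matrix_mult)
  have "inj_on \<gamma> S"
  proof (subst linear_injective_on_subspace_0[OF lin S], intro ballI impI)
    fix a assume a: "a \<in> S" "\<gamma> a = 0"
    then have "a = a v* A" by (simp add: \<gamma>_def)
    then have "a \<bullet> a = 0" using ort[OF a(1) At] by metis
    then show "a = 0" by simp
  qed
  then have "dim (\<gamma> ` S) = dim S"
    using dim_image_eq[OF lin] S by (metis span_eq_iff)
  moreover have "subspace (\<gamma> ` S)" using lin S by (rule linear_subspace_image)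
  moreover have "1 / real (dim S * dim (S\<^sup>\<bottom>) + 1)
      \<le> measure M {p \<in> space M. 0 \<le> (f \<bullet> z p) * (g \<bullet> z p) + \<epsilon> * (f \<bullet> g)}"
    if f: "f \<in> S\<^sup>\<bottom>" and g: "g \<in> \<gamma> ` S" for f g
  proof -
    obtain a where a: "a \<in> S" "g = \<gamma> a" using g by blast
    have X_rank_one: "X p A \<bullet> outer a f = (f \<bullet> z p) * (g \<bullet> z p) + \<epsilon> * (f \<bullet> g)" for p
    proof -
      let ?x = "P (z p)" and ?y = "Q (z p)"
      have z: "z p = ?x + ?y" by (simp add: Q_def)
      have 1: "f \<bullet> z p = f \<bullet> ?y"
        using ort[OF P(2) f, of "z p"] by (subst z) (simp add: inner_add_right inner_commute)
      have "g \<bullet> z p = a \<bullet> ?x - (a v* A) \<bullet> ?y"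
        using ort[OF a(1) Q(2), of "z p"] ort[OF P(2) At, of "z p" a]
        by (subst z) (simp add: a(2) \<gamma>_def inner_add_right inner_diff_left inner_diff_right inner_commute)
      then have 2: "g \<bullet> z p = a \<bullet> (?x - A *v ?y)"
        by (simp only: dot_lmul_matrix inner_diff_right)
      have "f \<bullet> g = - ((a v* A) \<bullet> f)"
        using ort[OF a(1) f] by (simp add: a(2) \<gamma>_def inner_diff_right inner_commute)
      then have 3: "f \<bullet> g = - (A \<bullet> outer a f)"
        by (simp only: dot_lmul_matrix inner_commute[of A] outer_inner)
      show ?thesis
        unfolding X_inner 1 2 3 by (simp add: outer_apply inner_commute mult.commute)
    qed
    have "outer a f \<in> L"
      unfolding L_def hom_space_def using a f by (intro span_base) auto
    then have "1 / real (dim L + 1)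
        \<le> measure M {p \<in> space M. 0 \<le> (f \<bullet> z p) * (g \<bullet> z p) + \<epsilon> * (f \<bullet> g)}"
      using A unfolding X_rank_one[symmetric] by blast
    moreover have "dim L \<le> dim S * dim (S\<^sup>\<bottom>)"
      unfolding L_def using S by (rule dim_hom_space)
    then have "1 / real (dim S * dim (S\<^sup>\<bottom>) + 1) \<le> 1 / real (dim L + 1)"
      by (intro divide_left_mono) (auto simp flip: of_nat_mult)
    ultimately show ?thesis by linarith
  qed
  ultimately show ?thesis by blast
qed

section \<open>Removing the regularization\<close>

text \<open>Compactness of the Grassmannian: the subspaces are images of \<open>S\<close> under linear isometries,
  which have a convergent subsequence when extended by \<open>0\<close> on \<open>S\<^sup>\<bottom>\<close>.\<close>

lemma convergent_subspaces:
  fixes S :: "'a::euclidean_space set" and G :: "nat \<Rightarrow> 'a set"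
  assumes S: "subspace S" and G: "\<And>j. subspace (G j)" "\<And>j. dim (G j) = dim S"
  obtains r G' where "strict_mono (r :: nat \<Rightarrow> nat)" "subspace G'" "dim G' = dim S"
    "\<And>g. g \<in> G' \<Longrightarrow> \<exists>\<gamma>. (\<forall>j. \<gamma> j \<in> G (r j)) \<and> \<gamma> \<longlonglongrightarrow> g"
proof -
  obtain P where P: "linear P" "\<And>w. P w \<in> S" "\<And>w. w - P w \<in> S\<^sup>\<bottom>"
    using orthogonal_projection_exists[OF S] by blast
  have P_id: "P a = a" if "a \<in> S" for a
  proof -
    have "a - P a \<in> S" using that P(2) S by (intro subspace_diff)
    then have "orthogonal (a - P a) (a - P a)" using P(3)[of a] unfolding orthogonal_comp_def by blast
    then show ?thesis by (simp add: orthogonal_def)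
  qed
  have P_le: "norm (P w) \<le> norm w" for w
  proof -
    have "orthogonal (P w) (w - P w)" using P(2,3)[of w] by (auto simp: orthogonal_comp_def)
    then have "(norm w)\<^sup>2 = (norm (P w))\<^sup>2 + (norm (w - P w))\<^sup>2"
      using norm_add_Pythagorean[of "P w" "w - P w"] by simp
    then show ?thesis by (metis le_add_same_cancel1 norm_ge_zero power2_le_imp_le zero_le_power2)
  qed
  have "\<exists>\<Phi> :: 'a \<Rightarrow>\<^sub>L 'a. norm \<Phi> \<le> 1 \<and> (\<forall>a\<in>S. blinfun_apply \<Phi> a \<in> G j \<and> norm (blinfun_apply \<Phi> a) = norm a)" for j
  proof -
    obtain f where f: "linear f" "f ` S = G j" "\<And>x. x \<in> S \<Longrightarrow> norm (f x) = norm x"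
      using isometry_subspaces[OF S G(1)] G(2) by metis
    have "bounded_linear (f \<circ> P)"
      using f(1) P(1) by (simp add: linear_compose linear_linear)
    then have ap: "blinfun_apply (Blinfun (f \<circ> P)) = f \<circ> P" by (rule bounded_linear_Blinfun_apply)
    have "norm (Blinfun (f \<circ> P)) \<le> 1"
      by (rule norm_blinfun_bound) (auto simp: ap f(3) P(2) P_le)
    then show ?thesis
      using f(2,3) P_id by (intro exI[of _ "Blinfun (f \<circ> P)"]) (auto simp: ap)
  qed
  then obtain \<Phi> :: "nat \<Rightarrow> 'a \<Rightarrow>\<^sub>L 'a" where \<Phi>: "\<And>j. norm (\<Phi> j) \<le> 1"
    "\<And>j a. a \<in> S \<Longrightarrow> blinfun_apply (\<Phi> j) a \<in> G j" "\<And>j a. a \<in> S \<Longrightarrow> norm (blinfun_apply (\<Phi> j) a) = norm a"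
    by metis
  have "bounded (range \<Phi>)" using \<Phi>(1) by (auto simp: bounded_iff)
  then obtain \<Psi> r where r: "strict_mono (r :: nat \<Rightarrow> nat)" and lim: "(\<Phi> \<circ> r) \<longlonglongrightarrow> \<Psi>"
    using bounded_imp_convergent_subsequence by blast
  have lim_a: "(\<lambda>j. blinfun_apply (\<Phi> (r j)) a) \<longlonglongrightarrow> blinfun_apply \<Psi> a" for a
    using lim by (auto simp: o_def intro!: blinfun.tendsto)
  have \<Psi>_norm: "norm (blinfun_apply \<Psi> a) = norm a" if "a \<in> S" for a
    using tendsto_norm[OF lim_a[of a]] \<Phi>(3)[OF that] by (simp add: LIMSEQ_const_iff)
  have lin: "linear (blinfun_apply \<Psi>)" by (simp add: blinfun.bounded_linear_right bounded_linear.linear)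
  have "inj_on (blinfun_apply \<Psi>) S"
    using \<Psi>_norm by (subst linear_injective_on_subspace_0[OF lin S]) force
  then have "dim (blinfun_apply \<Psi> ` S) = dim S"
    using dim_image_eq[OF lin] S by (metis span_eq_iff)
  moreover have "subspace (blinfun_apply \<Psi> ` S)" using lin S by (rule linear_subspace_image)
  moreover have "\<exists>\<gamma>. (\<forall>j. \<gamma> j \<in> G (r j)) \<and> \<gamma> \<longlonglongrightarrow> g" if "g \<in> blinfun_apply \<Psi> ` S" for g
  proof -
    obtain a where "a \<in> S" "g = blinfun_apply \<Psi> a" using \<open>g \<in> blinfun_apply \<Psi> ` S\<close> by blast
    then show ?thesis
      using lim_a[of a] \<Phi>(2) by (intro exI[of _ "\<lambda>j. blinfun_apply (\<Phi> (r j)) a"]) auto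
  qed
  ultimately show thesis using that r by blast
qed

text \<open>The linear-algebraic core of the theorem; \<open>G\<close> plays the role of the normals of the
  hyperplanes that contain \<open>W\<close>.\<close>

theorem dual_subspace_exists:
  fixes z :: "'p \<Rightarrow> real ^ 'n::finite" and S :: "(real ^ 'n) set"
  assumes M: "prob_space M" and S: "subspace S"
    and unit: "\<And>p. p \<in> space M \<Longrightarrow> norm (z p) = 1"
    and meas: "\<forall>F :: real ^ 'n \<Rightarrow> real. continuous_on UNIV F \<longrightarrow> (\<forall>x. F (- x) = F x) \<longrightarrow>
      (\<lambda>p. F (z p)) \<in> borel_measurable M"
  obtains G where "subspace G" "dim G = dim S"
    "\<And>f g. f \<in> S\<^sup>\<bottom> \<Longrightarrow> g \<in> G \<Longrightarrow> 1 / real (dim S * dim (S\<^sup>\<bottom>) + 1)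
      \<le> measure M {p \<in> space M. 0 \<le> (f \<bullet> z p) * (g \<bullet> z p)}"
proof -
  define c where "c = 1 / real (dim S * dim (S\<^sup>\<bottom>) + 1)"
  have "\<exists>G. \<forall>j. subspace (G j) \<and> dim (G j) = dim S \<and> (\<forall>f\<in>S\<^sup>\<bottom>. \<forall>g\<in>G j. c
      \<le> measure M {p \<in> space M. 0 \<le> (f \<bullet> z p) * (g \<bullet> z p) + inverse (real (Suc j)) * (f \<bullet> g)})"
    unfolding c_def
  proof (intro choice allI regularized_subspace_exists[OF M S, where z = z])
    show "norm (z p) = 1" if "p \<in> space M" for p using that by (rule unit)
  qed (use meas in simp_all)
  then obtain G where "\<forall>j. subspace (G j) \<and> dim (G j) = dim S \<and> (\<forall>f\<in>S\<^sup>\<bottom>. \<forall>g\<in>G j. c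
      \<le> measure M {p \<in> space M. 0 \<le> (f \<bullet> z p) * (g \<bullet> z p) + inverse (real (Suc j)) * (f \<bullet> g)})" ..
  then have G: "\<And>j. subspace (G j)" "\<And>j. dim (G j) = dim S"
    "\<And>j f g. f \<in> S\<^sup>\<bottom> \<Longrightarrow> g \<in> G j \<Longrightarrow> c
      \<le> measure M {p \<in> space M. 0 \<le> (f \<bullet> z p) * (g \<bullet> z p) + inverse (real (Suc j)) * (f \<bullet> g)}"
    by auto
  obtain r G' where r: "strict_mono (r :: nat \<Rightarrow> nat)" and G': "subspace G'" "dim G' = dim S"
    "\<And>g. g \<in> G' \<Longrightarrow> \<exists>\<gamma>. (\<forall>j. \<gamma> j \<in> G (r j)) \<and> \<gamma> \<longlonglongrightarrow> g"
    using convergent_subspaces[OF S, of G] G(1,2) by metis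
  have prod_meas: "(\<lambda>p. (f \<bullet> z p) * (g \<bullet> z p)) \<in> borel_measurable M" for f g
    by (rule meas[rule_format]) (auto intro!: continuous_intros)
  have "c \<le> measure M {p \<in> space M. 0 \<le> (f \<bullet> z p) * (g \<bullet> z p)}" if f: "f \<in> S\<^sup>\<bottom>" and g: "g \<in> G'" for f g
  proof -
    obtain \<gamma> where \<gamma>: "\<And>j. \<gamma> j \<in> G (r j)" "\<gamma> \<longlonglongrightarrow> g" using G'(3)[OF g] by blast
    define \<epsilon> where "\<epsilon> j = inverse (real (Suc (r j)))" for j
    have "((\<lambda>j. inverse (real (Suc j))) \<circ> r) \<longlonglongrightarrow> 0"
      using LIMSEQ_inverse_real_of_nat r by (rule LIMSEQ_subseq_LIMSEQ)
    then have \<epsilon>: "\<epsilon> \<longlonglongrightarrow> 0" by (simp add: \<epsilon>_def[abs_def] o_def)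
    show ?thesis
    proof (rule measure_nonneg_limit[where h = "\<lambda>j p. (f \<bullet> z p) * (\<gamma> j \<bullet> z p) + \<epsilon> j * (f \<bullet> \<gamma> j)"])
      show "finite_measure M" using M by (rule prob_space.finite_measure)
      show "(\<lambda>j. (f \<bullet> z p) * (\<gamma> j \<bullet> z p) + \<epsilon> j * (f \<bullet> \<gamma> j)) \<longlonglongrightarrow> (f \<bullet> z p) * (g \<bullet> z p)" for p
        using \<gamma>(2) \<epsilon> by (auto intro!: tendsto_eq_intros)
      show "c \<le> measure M {p \<in> space M. 0 \<le> (f \<bullet> z p) * (\<gamma> j \<bullet> z p) + \<epsilon> j * (f \<bullet> \<gamma> j)}" for j
        unfolding \<epsilon>_def using f \<gamma>(1) by (rule G(3))
    qed (use prod_meas in auto)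
  qed
  with G'(1,2) show thesis using that unfolding c_def by blast
qed

section \<open>Unit representatives of points of projective space\<close>

definition rep :: "'n::finite rproj \<Rightarrow> real ^ 'n"
  where "rep p = (SOME w. w \<in> line p \<and> norm w = 1)"

definition class_of :: "real ^ 'n::finite \<Rightarrow> 'n rproj"
  where "class_of w = Abs_rproj (span {w})"

lemma line_class_of: "w \<noteq> 0 \<Longrightarrow> line (class_of w) = span {w}"
  unfolding class_of_def by (intro Abs_rproj_inverse) (simp add: dim_insert)

lemma in_line_class_of: "w \<noteq> 0 \<Longrightarrow> w \<in> line (class_of w)"
  by (simp add: line_class_of span_base)

lemma rep: "rep p \<in> line p" "norm (rep p) = 1"
proof -
  have L: "subspace (line p)" "dim (line p) = 1" using line[of p] by auto
  then have "\<exists>w\<in>line p. w \<noteq> 0"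
    by (metis dim_eq_0 subsetI insertI1 zero_neq_one singleton_iff)
  then obtain w where w: "w \<in> line p" "w \<noteq> 0" by blast
  have "\<exists>w. w \<in> line p \<and> norm w = 1"
    using w L(1) by (intro exI[of _ "inverse (norm w) *\<^sub>R w"]) (auto intro: subspace_scale)
  then show "rep p \<in> line p" "norm (rep p) = 1"
    unfolding rep_def by (metis (mono_tags, lifting) someI_ex)+
qed

lemma rep_nonzero: "rep p \<noteq> 0"
  using rep(2)[of p] by auto

lemma class_of_rep: "class_of (rep p) = p"
  using line_meet_eq[OF in_line_class_of rep(1)] rep_nonzero by metis

lemma line_eq_span_rep: "line p = span {rep p}"
  by (metis class_of_rep line_class_of rep_nonzero)

lemma line_subset_iff: "subspace S \<Longrightarrow> line p \<subseteq> S \<longleftrightarrow> rep p \<in> S"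
  by (metis rep(1) line_eq_span_rep span_minimal empty_subsetI insert_subset subsetD)

lemma rep_class_of:
  assumes "w \<noteq> 0"
  obtains t where "t \<noteq> 0" "rep (class_of w) = t *\<^sub>R w"
proof -
  obtain t where t: "rep (class_of w) = t *\<^sub>R w"
    using rep(1)[of "class_of w"] assms by (auto simp: line_class_of span_singleton)
  moreover have "t \<noteq> 0" using rep_nonzero[of "class_of w"] t by auto
  ultimately show thesis using that by blast
qed

lemma Union_lines_minus_0:
  "(\<Union>p\<in>U. line p) - {0} = class_of -` U \<inter> - {0}"
proof -
  have "w \<in> (\<Union>p\<in>U. line p) \<longleftrightarrow> class_of w \<in> U" if "w \<noteq> 0" for w
  proof
    assume "w \<in> (\<Union>p\<in>U. line p)"
    then obtain p where "p \<in> U" "w \<in> line p" by blast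
    then show "class_of w \<in> U"
      using line_meet_eq[OF _ in_line_class_of[OF that] that] by blast
  qed (use in_line_class_of[OF that] in blast)
  then show ?thesis by blast
qed

lemma continuous_on_class_of: "continuous_on (- {0}) class_of"
proof -
  have "open (class_of -` U \<inter> - {0})" if "open U" for U :: "'a rproj set"
    using that by (simp add: open_rproj_def Union_lines_minus_0)
  then show ?thesis
    by (simp add: continuous_on_open_vimage open_Compl)
qed

text \<open>The unit vectors \<open>rep p\<close> jump between the two possible signs, but an even function does not
  notice: composed with the quotient map it is \<open>w \<mapsto> F (w / norm w)\<close>.\<close>

lemma continuous_on_rep_even:
  fixes F :: "real ^ 'n::finite \<Rightarrow> 'b::topological_space"
  assumes F: "continuous_on (- {0}) F" and even: "\<And>x. F (- x) = F x"
  shows "continuous_on UNIV (\<lambda>p. F (rep p))"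
proof -
  have "open ((\<lambda>p. F (rep p)) -` U)" if "open U" for U
  proof -
    define N :: "real ^ 'n \<Rightarrow> real ^ 'n" where "N w = inverse (norm w) *\<^sub>R w" for w
    have eq: "F (rep (class_of w)) = F (N w)" if w: "w \<noteq> 0" for w
    proof -
      obtain t where t: "t \<noteq> 0" "rep (class_of w) = t *\<^sub>R w" using rep_class_of[OF w] .
      then have "\<bar>t\<bar> * norm w = 1" using rep(2)[of "class_of w"] by simp
      then have "\<bar>t\<bar> = inverse (norm w)" using w by (simp add: field_simps)
      then have "rep (class_of w) = N w \<or> rep (class_of w) = - N w"
        unfolding t(2) N_def by (auto simp: abs_if split: if_splits) (metis minus_minus scaleR_minus_left)
      then show ?thesis using even by auto
    qed
    have "continuous_on (- {0}) (\<lambda>w. F (N w))"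
      unfolding N_def by (intro continuous_on_compose2[OF F]) (auto intro!: continuous_intros)
    then have "open ((\<lambda>w. F (N w)) -` U \<inter> - {0})"
      using that by (simp add: continuous_on_open_vimage open_Compl)
    moreover have "(\<Union>p\<in>(\<lambda>p. F (rep p)) -` U. line p) - {0} = (\<lambda>w. F (N w)) -` U \<inter> - {0}"
      unfolding Union_lines_minus_0 using eq by auto
    ultimately show ?thesis by (simp add: open_rproj_def)
  qed
  then show ?thesis by (simp add: continuous_on_open_vimage)
qed

lemma proj_hyperplane_normal:
  fixes H :: "'n::finite rproj set"
  assumes "proj_hyperplane H"
  obtains f where "f \<noteq> 0" "H = {p. f \<bullet> rep p = 0}"
proof -
  obtain S :: "(real ^ 'n) set" where S: "subspace S" "int (dim S) = int CARD('n) - 1"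
    "H = {p. line p \<subseteq> S}"
    using assms by (auto simp: proj_hyperplane_def proj_subspace_def)
  then obtain f where f: "f \<noteq> 0" "span S \<subseteq> {x. f \<bullet> x = 0}"
    using lowdim_subset_hyperplane[of S] by auto
  have "S = {x. f \<bullet> x = 0}"
    using f S dim_hyperplane[OF f(1)]
    by (intro subspace_dim_equal) (auto simp: subspace_hyperplane span_eq_iff[THEN iffD2])
  then have "H = {p. f \<bullet> rep p = 0}"
    using S(1,3) by (auto simp: line_subset_iff)
  with f(1) show thesis using that by blast
qed

lemma normal_orthogonal:
  assumes "subspace S" "{p. line p \<subseteq> S} \<subseteq> {p. f \<bullet> rep p = 0}"
  shows "f \<in> S\<^sup>\<bottom>"
proof -
  have "orthogonal s f" if s: "s \<in> S" for s
  proof (cases "s = 0")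
    case False
    obtain t where t: "t \<noteq> 0" "rep (class_of s) = t *\<^sub>R s" using rep_class_of[OF False] .
    then have "rep (class_of s) \<in> S" using s assms(1) by (simp add: subspace_scale)
    then have "f \<bullet> rep (class_of s) = 0" using assms by (auto simp: line_subset_iff)
    then show ?thesis using t by (simp add: orthogonal_def inner_commute)
  qed (simp add: orthogonal_clauses)
  then show ?thesis by (simp add: orthogonal_comp_def)
qed

section \<open>The two parts cut out by a pair of hyperplanes\<close>

text \<open>The sum of the two normalized vectors, up to scaling; strictness in the Cauchy-Schwarz
  inequality is what positivity requires.\<close>

lemma same_side_vector:
  fixes f g :: "'a::real_inner"
  assumes "f \<noteq> 0" "g \<noteq> 0" "norm f *\<^sub>R g \<noteq> - (norm g *\<^sub>R f)"
  obtains u where "0 < f \<bullet> u" "0 < g \<bullet> u"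
proof
  have "f \<bullet> g \<noteq> - (norm f * norm g)"
    using assms norm_cauchy_schwarz_eq[of "-f" g] by auto
  then have *: "0 < norm f * norm g + f \<bullet> g"
    using norm_cauchy_schwarz[of "-f" g] by simp
  let ?u = "norm g *\<^sub>R f + norm f *\<^sub>R g"
  have "f \<bullet> ?u = norm f * (norm f * norm g + f \<bullet> g)"
    by (simp add: inner_add_right power2_norm_eq_inner[symmetric] power2_eq_square algebra_simps)
  then show "0 < f \<bullet> ?u" using * assms by simp
  have "g \<bullet> ?u = norm g * (norm f * norm g + f \<bullet> g)"
    by (simp add: inner_add_right power2_norm_eq_inner[symmetric] power2_eq_square inner_commute algebra_simps)
  then show "0 < g \<bullet> ?u" using * assms by simp
qed

definition pos_part :: "real ^ 'n \<Rightarrow> real ^ 'n \<Rightarrow> 'n::finite rproj set"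
  where "pos_part f g = {p. 0 < (f \<bullet> rep p) * (g \<bullet> rep p)}"

lemma pos_part_class_of:
  assumes "w \<noteq> 0"
  shows "class_of w \<in> pos_part f g \<longleftrightarrow> 0 < (f \<bullet> w) * (g \<bullet> w)"
proof -
  obtain t where t: "t \<noteq> 0" "rep (class_of w) = t *\<^sub>R w" using rep_class_of[OF assms] .
  have "(f \<bullet> t *\<^sub>R w) * (g \<bullet> t *\<^sub>R w) = t\<^sup>2 * ((f \<bullet> w) * (g \<bullet> w))"
    by (simp add: power2_eq_square)
  moreover have "0 < t\<^sup>2" using t(1) by simp
  ultimately show ?thesis unfolding pos_part_def mem_Collect_eq t(2) by (metis zero_less_mult_pos mult_pos_pos)
qed

lemma open_pos_part: "open (pos_part f g)"
proof -
  have "continuous_on UNIV (\<lambda>p. (f \<bullet> rep p) * (g \<bullet> rep p))"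
    by (rule continuous_on_rep_even[of "\<lambda>w. (f \<bullet> w) * (g \<bullet> w)"]) (auto intro!: continuous_intros)
  then show ?thesis
    unfolding pos_part_def by (intro open_Collect_less) auto
qed

text \<open>It is the image of the convex cone where both forms are positive.\<close>

lemma connected_pos_part: "connected (pos_part f g)"
proof -
  define C where "C = {w. 0 < f \<bullet> w} \<inter> {w. 0 < g \<bullet> w}"
  have "pos_part f g = class_of ` C"
  proof (intro equalityI subsetI)
    fix p assume "p \<in> pos_part f g"
    then have "rep p \<in> C \<or> - rep p \<in> C"
      by (auto simp: pos_part_def C_def zero_less_mult_iff)
    moreover have "class_of (- rep p) = p"
    proof (rule line_meet_eq)
      show "- rep p \<in> line p" using rep(1)[of p] line[of p] by (auto intro: subspace_neg)
    qed (auto simp: rep_nonzero in_line_class_of)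
    ultimately show "p \<in> class_of ` C" by (metis class_of_rep image_eqI)
  next
    fix p assume "p \<in> class_of ` C"
    then obtain w where w: "p = class_of w" "0 < f \<bullet> w" "0 < g \<bullet> w" by (auto simp: C_def)
    then have "w \<noteq> 0" by auto
    with w show "p \<in> pos_part f g" by (simp add: pos_part_class_of)
  qed
  moreover have "connected C"
    unfolding C_def by (intro convex_connected convex_Int convex_halfspace_gt)
  moreover have "continuous_on C class_of"
    by (rule continuous_on_subset[OF continuous_on_class_of]) (auto simp: C_def)
  ultimately show ?thesis by (simp add: connected_continuous_image)
qed

text \<open>A point where the product of the forms vanishes is approached by moving its representative,
  with the right sign, in a direction in which both forms increase.\<close>

lemma closure_pos_part:
  assumes u: "0 < f \<bullet> u" "0 < g \<bullet> u"
  shows "closure (pos_part f g) = {p. 0 \<le> (f \<bullet> rep p) * (g \<bullet> rep p)}"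
proof
  have "continuous_on UNIV (\<lambda>p. (f \<bullet> rep p) * (g \<bullet> rep p))"
    by (rule continuous_on_rep_even[of "\<lambda>w. (f \<bullet> w) * (g \<bullet> w)"]) (auto intro!: continuous_intros)
  then have "closed {p. 0 \<le> (f \<bullet> rep p) * (g \<bullet> rep p)}"
    by (intro closed_Collect_le) auto
  then show "closure (pos_part f g) \<subseteq> {p. 0 \<le> (f \<bullet> rep p) * (g \<bullet> rep p)}"
    by (intro closure_minimal) (auto simp: pos_part_def)
next
  show "{p. 0 \<le> (f \<bullet> rep p) * (g \<bullet> rep p)} \<subseteq> closure (pos_part f g)"
  proof
    fix p assume "p \<in> {p. 0 \<le> (f \<bullet> rep p) * (g \<bullet> rep p)}"
    then have "\<exists>s\<in>{1, - 1 :: real}. 0 \<le> s * (f \<bullet> rep p) \<and> 0 \<le> s * (g \<bullet> rep p)"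
      by (auto simp: zero_le_mult_iff)
    then obtain s :: real where s: "s \<noteq> 0" "0 \<le> s * (f \<bullet> rep p)" "0 \<le> s * (g \<bullet> rep p)"
      by (metis insert_iff singletonD zero_neq_one zero_neq_neg_one)
    \<comment> \<open>The factor \<open>s\<close> turns the representative to the side where both forms are nonnegative.\<close>
    define w where "w j = rep p + (s * inverse (real (Suc j))) *\<^sub>R u" for j
    have pos: "0 < (f \<bullet> w j) * (g \<bullet> w j)" for j
    proof -
      have "0 < s * (h \<bullet> w j)" if "0 \<le> s * (h \<bullet> rep p)" "0 < h \<bullet> u" for h
      proof -
        have "s * (h \<bullet> w j) = s * (h \<bullet> rep p) + s\<^sup>2 * inverse (real (Suc j)) * (h \<bullet> u)"
          by (simp add: w_def inner_add_right power2_eq_square algebra_simps)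
        moreover have "0 < s\<^sup>2 * inverse (real (Suc j)) * (h \<bullet> u)"
          using s(1) that(2) by simp
        ultimately show ?thesis using that(1) by linarith
      qed
      then have "0 < (s * (f \<bullet> w j)) * (s * (g \<bullet> w j))"
        using s(2,3) u by (intro mult_pos_pos[of "s * (f \<bullet> w j)" "s * (g \<bullet> w j)"])
      then have "0 < s\<^sup>2 * ((f \<bullet> w j) * (g \<bullet> w j))"
        by (simp add: power2_eq_square mult_ac)
      moreover have "0 < s\<^sup>2" using s(1) by simp
      ultimately show ?thesis by (rule zero_less_mult_pos)
    qed
    have nz: "w j \<noteq> 0" for j using pos[of j] by auto
    have "(\<lambda>j. rep p + (s * inverse (real (Suc j))) *\<^sub>R u) \<longlonglongrightarrow> rep p + (s * 0) *\<^sub>R u"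
      by (intro tendsto_intros LIMSEQ_inverse_real_of_nat)
    then have "w \<longlonglongrightarrow> rep p" by (simp add: w_def[abs_def])
    then have lim: "(\<lambda>j. class_of (w j)) \<longlonglongrightarrow> class_of (rep p)"
      using nz rep_nonzero
      by (intro continuous_on_tendsto_compose[OF continuous_on_class_of]) auto
    have "class_of (w j) \<in> closure (pos_part f g)" for j
      using pos nz closure_subset pos_part_class_of by blast
    then show "p \<in> closure (pos_part f g)"
      using Lim_in_closed_set[OF closed_closure _ _ lim] by (simp add: class_of_rep)
  qed
qed

lemma components_two_open:
  fixes U V :: "'a::topological_space set"
  assumes "open U" "open V" "connected U" "connected V" "U \<noteq> {}" "V \<noteq> {}" "U \<inter> V = {}"
  shows "components (U \<union> V) = {U, V}"
proof -
  have comp: "U \<in> components (U \<union> V)"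
    if "open U" "open V" "connected U" "U \<noteq> {}" "U \<inter> V = {}" for U V :: "'a set"
    unfolding in_components_maximal
  proof (intro conjI allI impI, goal_cases)
    case (4 D)
    then have "D \<inter> V = {}"
      using connectedD[of D U V] that by blast
    with 4 show "D = U" by blast
  qed (use that in auto)
  have "U \<in> components (U \<union> V)" "V \<in> components (U \<union> V)"
    using comp[of U V] comp[of V U] assms by (auto simp: Un_commute)
  moreover have "C \<in> {U, V}" if "C \<in> components (U \<union> V)" for C
  proof -
    have "C \<noteq> {}" "C \<subseteq> U \<union> V" using that in_components_nonempty in_components_subset by blast+
    then have "C \<inter> U \<noteq> {} \<or> C \<inter> V \<noteq> {}" by blast
    with that calculation show ?thesis
      by (metis components_nonoverlap insertCI)
  qed
  ultimately show ?thesis by blast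
qed

text \<open>The sign of \<open>h\<close> matters when the hyperplanes coincide: then \<open>f\<close> and \<open>g\<close> are proportional,
  and the first part is the hyperplane only if the factor from \<open>f\<close> to \<open>h\<close> is
  negative. When they are distinct, either sign will do.\<close>

lemma partition_by_forms:
  fixes f g :: "real ^ 'n::finite"
  assumes "f \<noteq> 0" "g \<noteq> 0"
  defines "H1 \<equiv> {p. f \<bullet> rep p = 0}" and "H2 \<equiv> {p. g \<bullet> rep p = 0}"
  obtains h where "h \<in> {g, - g}" "partitions_into H1 H2
    {p. 0 \<le> (f \<bullet> rep p) * (h \<bullet> rep p)} {p. 0 \<le> (f \<bullet> rep p) * (- h \<bullet> rep p)}"
proof (cases "H1 = H2")
  case True
  define S where "S = {x. f \<bullet> x = 0}"
  have S: "subspace S" unfolding S_def by (rule subspace_hyperplane)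
  have "{p. line p \<subseteq> S} = {p. g \<bullet> rep p = 0}"
    using True unfolding H1_def H2_def line_subset_iff[OF S] by (simp add: S_def)
  then have gS: "g \<in> S\<^sup>\<bottom>" using normal_orthogonal[OF S] by blast
  define t where "t = (f \<bullet> g) / (f \<bullet> f)"
  define e where "e = g - t *\<^sub>R f"
  have fe: "f \<bullet> e = 0" using assms(1) by (simp add: e_def t_def inner_diff_right)
  then have "g \<bullet> e = 0" using gS by (auto simp: S_def orthogonal_comp_def orthogonal_def inner_commute)
  then have "e \<bullet> e = 0" using fe by (simp add: e_def inner_diff_left)
  then have g: "g = t *\<^sub>R f" by (simp add: e_def)
  \<comment> \<open>With this sign \<open>f h\<close> is \<open>- \<bar>t\<bar> f\<^sup>2\<close>, which is nonnegative only on the hyperplane.\<close>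
  define h where "h = (if t > 0 then - g else g)"
  have h: "h = (- \<bar>t\<bar>) *\<^sub>R f" by (auto simp: h_def g)
  have "t \<noteq> 0" using g assms(2) by auto
  have eq: "(f \<bullet> w) * (h \<bullet> w) = - (\<bar>t\<bar> * (f \<bullet> w)\<^sup>2)" for w
    by (simp add: h power2_eq_square)
  have P1: "{p. 0 \<le> (f \<bullet> rep p) * (h \<bullet> rep p)} = H1"
    using \<open>t \<noteq> 0\<close> unfolding eq H1_def by (auto simp: mult_le_0_iff)
  have P2: "{p. 0 \<le> (f \<bullet> rep p) * (- h \<bullet> rep p)} = UNIV"
    using eq by auto
  show thesis
  proof (rule that)
    show "h \<in> {g, - g}" by (simp add: h_def)
    show "partitions_into H1 H2 {p. 0 \<le> (f \<bullet> rep p) * (h \<bullet> rep p)}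
        {p. 0 \<le> (f \<bullet> rep p) * (- h \<bullet> rep p)}"
      unfolding P1 P2 partitions_into_def using True by simp
  qed
next
  case False
  have no_multiple: "g \<noteq> t *\<^sub>R f" for t
    using False assms(2) by (auto simp: H1_def H2_def)
  have ne: "norm f *\<^sub>R g \<noteq> - (norm g *\<^sub>R f)" "norm f *\<^sub>R (- g) \<noteq> - (norm (- g) *\<^sub>R f)"
  proof -
    have "norm f *\<^sub>R g \<noteq> s *\<^sub>R f" for s
    proof
      assume "norm f *\<^sub>R g = s *\<^sub>R f"
      then have "inverse (norm f) *\<^sub>R norm f *\<^sub>R g = inverse (norm f) *\<^sub>R s *\<^sub>R f" by simp
      then have "g = (inverse (norm f) * s) *\<^sub>R f" using assms(1) by simp
      then show False using no_multiple by blast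
    qed
    from this[of "- norm g"] this[of "norm g"]
    show "norm f *\<^sub>R g \<noteq> - (norm g *\<^sub>R f)" "norm f *\<^sub>R (- g) \<noteq> - (norm (- g) *\<^sub>R f)"
      by simp_all
  qed
  obtain u where u: "0 < f \<bullet> u" "0 < g \<bullet> u"
    using same_side_vector[OF assms(1,2) ne(1)] .
  obtain u' where u': "0 < f \<bullet> u'" "0 < - g \<bullet> u'"
    using same_side_vector[OF assms(1) _ ne(2)] assms(2) by auto
  have "u \<noteq> 0" "u' \<noteq> 0" using u u' by auto
  have mem: "class_of u \<in> pos_part f g" "class_of u' \<in> pos_part f (- g)"
    using u u' \<open>u \<noteq> 0\<close> \<open>u' \<noteq> 0\<close> by (simp_all add: pos_part_class_of mult_pos_neg)
  have disj: "pos_part f g \<inter> pos_part f (- g) = {}"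
    by (auto simp: pos_part_def)
  have "- (H1 \<union> H2) = pos_part f g \<union> pos_part f (- g)"
    by (auto simp: H1_def H2_def pos_part_def zero_less_mult_iff mult_less_0_iff)
  moreover have "components (pos_part f g \<union> pos_part f (- g)) = {pos_part f g, pos_part f (- g)}"
    using mem disj by (intro components_two_open open_pos_part connected_pos_part) auto
  ultimately have "components (- (H1 \<union> H2)) = {pos_part f g, pos_part f (- g)}" by metis
  moreover have "pos_part f g \<noteq> pos_part f (- g)" using mem disj by blast
  ultimately have "partitions_into H1 H2 (closure (pos_part f g)) (closure (pos_part f (- g)))"
    unfolding partitions_into_def if_not_P[OF False] by blast
  then show thesis
    unfolding closure_pos_part[OF u] closure_pos_part[OF u'] by (intro that[of g]) auto
qed

section \<open>Pairs of hyperplanes through dual subspaces\<close>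

theorem theorem1p3:
  fixes d :: nat and v :: int
    and V :: "'n::finite rproj set" and \<mu> :: "'n rproj measure"
  assumes "CARD('n) = d + 1"
    and "proj_subspace v V"
    and "prob_space \<mu>" and "sets \<mu> = sets borel"
  shows "\<exists>W. proj_subspace (int d - v - 1) W \<and>
    (\<forall>H1 H2. proj_hyperplane H1 \<and> proj_hyperplane H2 \<and> V \<subseteq> H1 \<and> W \<subseteq> H2 \<longrightarrow>
      (\<exists>P1 P2. partitions_into H1 H2 P1 P2 \<and>
        measure \<mu> P1 \<ge> 1 / ((real d - real_of_int v) * (real_of_int v + 1) + 1) \<and>
        measure \<mu> P2 \<ge> 1 / ((real d - real_of_int v) * (real_of_int v + 1) + 1)))"
proof -
  obtain S :: "(real ^ 'n) set" where S: "subspace S" "int (dim S) = v + 1" "V = {p. line p \<subseteq> S}"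
    using assms(2) by (auto simp: proj_subspace_def)
  have space: "space \<mu> = UNIV" using sets_eq_imp_space_eq[OF assms(4)] by simp
  have meas: "(\<lambda>p. F (rep p)) \<in> borel_measurable \<mu>"
    if "continuous_on UNIV F" "\<And>x. F (- x) = F x" for F :: "real ^ 'n \<Rightarrow> real"
  proof -
    have "continuous_on UNIV (\<lambda>p :: 'n rproj. F (rep p))"
      using continuous_on_subset[OF that(1)] that(2) by (intro continuous_on_rep_even) auto
    then have "(\<lambda>p. F (rep p)) \<in> borel_measurable borel" by (rule borel_measurable_continuous_onI)
    then show ?thesis by (simp add: measurable_cong_sets[OF assms(4) refl])
  qed
  obtain G where G: "subspace G" "dim G = dim S"
    "\<And>f g. f \<in> S\<^sup>\<bottom> \<Longrightarrow> g \<in> G \<Longrightarrow> 1 / real (dim S * dim (S\<^sup>\<bottom>) + 1)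
      \<le> measure \<mu> {p \<in> space \<mu>. 0 \<le> (f \<bullet> rep p) * (g \<bullet> rep p)}"
  proof (rule dual_subspace_exists[OF assms(3) S(1), where z = rep])
    show "norm (rep p) = 1" for p :: "'n rproj" by (rule rep(2))
  qed (use meas in auto)
  have le: "dim T \<le> d + 1" for T :: "(real ^ 'n) set"
    using dim_subset_UNIV[of T] assms(1) by simp
  have codim: "int (dim (T\<^sup>\<bottom>)) = int d - v" if "subspace T" "dim T = dim S" for T :: "(real ^ 'n) set"
    using dim_orthogonal_comp[OF that(1)] le[of T] that(2) S(2) assms(1) by simp
  have "real (dim S) = real_of_int v + 1" "real (dim (S\<^sup>\<bottom>)) = real d - real_of_int v"
    using S(2) codim[OF S(1) refl] by linarith+
  then have c: "real (dim S * dim (S\<^sup>\<bottom>) + 1) = (real d - real_of_int v) * (real_of_int v + 1) + 1"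
    by (simp add: mult.commute)
  define W where "W = {p :: 'n rproj. line p \<subseteq> G\<^sup>\<bottom>}"
  have "proj_subspace (int d - v - 1) W"
    unfolding proj_subspace_def W_def using codim[OF G(1,2)]
    by (intro exI[of _ "G\<^sup>\<bottom>"]) (simp add: subspace_orthogonal_comp)
  moreover have "\<exists>P1 P2. partitions_into H1 H2 P1 P2 \<and>
      measure \<mu> P1 \<ge> 1 / ((real d - real_of_int v) * (real_of_int v + 1) + 1) \<and>
      measure \<mu> P2 \<ge> 1 / ((real d - real_of_int v) * (real_of_int v + 1) + 1)"
    if H: "proj_hyperplane H1" "proj_hyperplane H2" "V \<subseteq> H1" "W \<subseteq> H2" for H1 H2
  proof -
    obtain f where f: "f \<noteq> 0" "H1 = {p. f \<bullet> rep p = 0}" using proj_hyperplane_normal[OF H(1)] .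
    obtain g where g: "g \<noteq> 0" "H2 = {p. g \<bullet> rep p = 0}" using proj_hyperplane_normal[OF H(2)] .
    have "f \<in> S\<^sup>\<bottom>" using normal_orthogonal[OF S(1)] H(3) f(2) S(3) by simp
    have "g \<in> G\<^sup>\<bottom>\<^sup>\<bottom>"
      using normal_orthogonal[OF subspace_orthogonal_comp] H(4) g(2) W_def by blast
    then have "g \<in> G" using orthogonal_comp_self[OF G(1)] by simp
    obtain h where h: "h \<in> {g, - g}" "partitions_into H1 H2
        {p. 0 \<le> (f \<bullet> rep p) * (h \<bullet> rep p)} {p. 0 \<le> (f \<bullet> rep p) * (- h \<bullet> rep p)}"
      by (rule partition_by_forms[OF f(1) g(1), folded f(2) g(2)])
    have "h \<in> G" "- h \<in> G" using h(1) \<open>g \<in> G\<close> G(1) by (auto intro: subspace_neg)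
    have bound: "1 / ((real d - real_of_int v) * (real_of_int v + 1) + 1)
        \<le> measure \<mu> {p. 0 \<le> (f \<bullet> rep p) * (k \<bullet> rep p)}" if "k \<in> G" for k
      using G(3)[OF \<open>f \<in> S\<^sup>\<bottom>\<close> that] unfolding c space by simp
    from h(2) bound[OF \<open>h \<in> G\<close>] bound[OF \<open>- h \<in> G\<close>] show ?thesis by blast
  qed
  ultimately show ?thesis by blast
qed

end
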